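(* Let $\mathcal{X}$ be a finite set, let $\pi$ be a probability measure on $\mathcal{X}$ with strictly positive masses, and let $G$ be the Gibbs kernel of a partition $\mathcal{X}=\bigsqcup_{i=1}^k\mathcal{O}_i$ into non-empty sets. For any $\pi$-reversible, ergodic and positive-definite transition matrix $P$ on $\mathcal{X}$, if $G\ne\Pi$ and $P\neq\Pi$, then $GPG\ne\Pi$.
   Context: The Gibbs kernel is $G(x,y)=\pi(y)/\pi(\mathcal{O}(x))$ if $y\in\mathcal{O}(x)$ and $0$ otherwise, where $\mathcal{O}(x)$ is the block containing $x$ and $\pi(A)=\sum_{z\in A}\pi(z)$. $\Pi$ is the matrix all of whose rows equal $\pi$. Ergodic means irreducible and aperiodic. $P$ is positive-definite if $\sum_xf(x)(Pf)(x)\pi(x)>0$ for all non-zero $f:\mathcal{X}\to\mathbb{R}$. *)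

theory Defs
  imports "HOL-Analysis.Analysis" "HOL-Probability.Probability" "HOL-Library.Disjoint_Sets"
begin

text \<open>
  The finite state space is a type of class \<open>finite\<close>. A kernel \<open>P\<close> is a square matrix
  with \<open>P $ x $ y\<close> the probability of moving from \<open>x\<close> to \<open>y\<close>; thus \<open>**\<close> is the
  composition of kernels and \<open>P *v f\<close> is the function \<open>Pf\<close>.
\<close>

definition block_of :: "'a set set \<Rightarrow> 'a \<Rightarrow> 'a set" where
  "block_of \<O> x = (THE B. B \<in> \<O> \<and> x \<in> B)"

definition gibbs_kernel :: "'a::finite pmf \<Rightarrow> 'a set set \<Rightarrow> real^'a^'a" where
  "gibbs_kernel \<pi> \<O> =
     (\<chi> x y. if y \<in> block_of \<O> x then pmf \<pi> y / measure_pmf.prob \<pi> (block_of \<O> x) else 0)"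

definition stationary_matrix :: "'a::finite pmf \<Rightarrow> real^'a^'a" where
  "stationary_matrix \<pi> = (\<chi> x y. pmf \<pi> y)"

definition transition_matrix :: "real^'a^'a::finite \<Rightarrow> bool" where
  "transition_matrix P \<longleftrightarrow> (\<forall>x y. 0 \<le> P $ x $ y) \<and> (\<forall>x. (\<Sum>y\<in>UNIV. P $ x $ y) = 1)"

definition reversible :: "'a::finite pmf \<Rightarrow> real^'a^'a \<Rightarrow> bool" where
  "reversible \<pi> P \<longleftrightarrow> (\<forall>x y. pmf \<pi> x * P $ x $ y = pmf \<pi> y * P $ y $ x)"

text \<open>The class operation \<open>*\<close> on \<open>real^'a^'a\<close> is componentwise, so \<open>^\<close> would not be
  the power with respect to matrix multiplication.\<close>

primrec matrix_pow :: "real^'a^'a::finite \<Rightarrow> nat \<Rightarrow> real^'a^'a" where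
  "matrix_pow P 0 = mat 1"
| "matrix_pow P (Suc n) = P ** matrix_pow P n"

definition irreducible_matrix :: "real^'a^'a::finite \<Rightarrow> bool" where
  "irreducible_matrix P \<longleftrightarrow> (\<forall>x y. \<exists>n. 0 < matrix_pow P n $ x $ y)"

definition state_period :: "real^'a^'a::finite \<Rightarrow> 'a \<Rightarrow> nat" where
  "state_period P x = Gcd {n. 1 \<le> n \<and> 0 < matrix_pow P n $ x $ x}"

definition aperiodic_matrix :: "real^'a^'a::finite \<Rightarrow> bool" where
  "aperiodic_matrix P \<longleftrightarrow> (\<forall>x. state_period P x = 1)"

definition ergodic_matrix :: "real^'a^'a::finite \<Rightarrow> bool" where
  "ergodic_matrix P \<longleftrightarrow> irreducible_matrix P \<and> aperiodic_matrix P"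

definition positive_definite :: "'a::finite pmf \<Rightarrow> real^'a^'a \<Rightarrow> bool" where
  "positive_definite \<pi> P \<longleftrightarrow>
     (\<forall>f::real^'a. f \<noteq> 0 \<longrightarrow> 0 < (\<Sum>x\<in>UNIV. f $ x * (P *v f) $ x * pmf \<pi> x))"

end

theory Submission
  imports Defs
begin

text \<open>
  \<open>G\<close> is the orthogonal projection, in \<open>L\<^sup>2(\<pi>)\<close>, onto the functions that are constant on blocks.
  If \<open>G \<noteq> \<Pi>\<close>, some block \<open>B\<close> is a proper subset of the state space, so \<open>f = 1\<^sub>B - \<pi>(B)\<close> is a
  non-zero function with \<open>Gf = f\<close> and \<open>\<Pi>f = 0\<close>. If \<open>GPG = \<Pi>\<close>, then
  \<open>\<langle>f, Pf\<rangle> = \<langle>Gf, PGf\<rangle> = \<langle>f, GPGf\<rangle> = \<langle>f, \<Pi>f\<rangle> = 0\<close>, against the positive-definiteness of \<open>P\<close>.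
\<close>

lemma block_of_eq:
  assumes "partition_on UNIV \<O>" "B \<in> \<O>" "x \<in> B"
  shows "block_of \<O> x = B"
  unfolding block_of_def
proof (rule the_equality)
  show "B \<in> \<O> \<and> x \<in> B"
    using assms by simp
  show "B' = B" if "B' \<in> \<O> \<and> x \<in> B'" for B'
    using disjointD[OF partition_onD2[OF assms(1)], of B' B] assms that by blast
qed

lemma
  assumes "partition_on UNIV \<O>"
  shows block_of_in: "block_of \<O> x \<in> \<O>"
    and in_block_of: "x \<in> block_of \<O> x"
proof -
  obtain B where "B \<in> \<O>" "x \<in> B"
    using partition_onD1[OF assms] by blast
  then show "block_of \<O> x \<in> \<O>" "x \<in> block_of \<O> x"
    using block_of_eq[OF assms] by simp_all
qed

text \<open>Turns membership into an equation symmetric in \<open>x\<close> and \<open>y\<close>,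
  the form in which both the reversibility of \<open>G\<close> and the block-constancy of
  \<open>f\<close> can be checked by rewriting.\<close>

lemma in_block_of_iff:
  assumes "partition_on UNIV \<O>"
  shows "y \<in> block_of \<O> x \<longleftrightarrow> block_of \<O> y = block_of \<O> x"
proof
  show "block_of \<O> y = block_of \<O> x" if "y \<in> block_of \<O> x"
    using that by (rule block_of_eq[OF assms block_of_in[OF assms]])
  show "y \<in> block_of \<O> x" if "block_of \<O> y = block_of \<O> x"
    using in_block_of[OF assms, of y] that by simp
qed

text \<open>Detailed balance swaps the indices in the weight \<open>pmf \<pi> x * K $ x $ y\<close>;
  exchanging the two sums then moves \<open>K\<close> to the other factor.\<close>

lemma reversible_self_adjoint:
  assumes "reversible \<pi> K"
  shows "(\<Sum>x\<in>UNIV. f $ x * (K *v g) $ x * pmf \<pi> x) = (\<Sum>x\<in>UNIV. (K *v f) $ x * g $ x * pmf \<pi> x)"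
proof -
  have "(\<Sum>x\<in>UNIV. f $ x * (K *v g) $ x * pmf \<pi> x)
      = (\<Sum>x\<in>UNIV. \<Sum>y\<in>UNIV. f $ x * g $ y * (pmf \<pi> x * K $ x $ y))"
    by (simp add: matrix_vector_mult_def sum_distrib_left sum_distrib_right mult_ac)
  also have "\<dots> = (\<Sum>x\<in>UNIV. \<Sum>y\<in>UNIV. f $ x * g $ y * (pmf \<pi> y * K $ y $ x))"
    using assms by (intro sum.cong refl) (simp add: reversible_def)
  also have "\<dots> = (\<Sum>y\<in>UNIV. \<Sum>x\<in>UNIV. f $ x * g $ y * (pmf \<pi> y * K $ y $ x))"
    by (rule sum.swap)
  also have "\<dots> = (\<Sum>x\<in>UNIV. (K *v f) $ x * g $ x * pmf \<pi> x)"
    by (simp add: matrix_vector_mult_def sum_distrib_left sum_distrib_right mult_ac)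
  finally show ?thesis .
qed

text \<open>Within a block B, both sides are \<pi>(x)\<pi>(y)/\<pi>(B); across blocks both
  vanish.\<close>

lemma reversible_gibbs_kernel:
  assumes "partition_on UNIV \<O>"
  shows "reversible \<pi> (gibbs_kernel \<pi> \<O>)"
  unfolding reversible_def gibbs_kernel_def
  by (auto simp: in_block_of_iff[OF assms])

text \<open>Row \<open>x\<close> of \<open>G\<close> is \<pi> conditioned on the block of
  \<open>x\<close>, and averaging a constant returns it.\<close>

lemma gibbs_kernel_fixes_block_constant:
  assumes "\<And>x. 0 < pmf \<pi> x" "partition_on UNIV \<O>"
    and const: "\<And>x y. y \<in> block_of \<O> x \<Longrightarrow> f $ y = f $ x"
  shows "gibbs_kernel \<pi> \<O> *v f = f"
proof (rule vec_eq_iff[THEN iffD2], rule allI)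
  fix x
  let ?B = "block_of \<O> x"
  \<comment> \<open>The point \<open>x\<close> alone gives its block positive mass, so the quotient
    is a genuine conditional probability.\<close>
  have "0 < measure_pmf.prob \<pi> ?B"
    using assms(1)[of x] in_block_of[OF assms(2), of x]
    by (intro measure_pmf_posI[of x]) (auto simp: set_pmf_iff)
  then have pos: "measure_pmf.prob \<pi> ?B \<noteq> 0" by simp
  have "(gibbs_kernel \<pi> \<O> *v f) $ x
      = (\<Sum>y\<in>UNIV. if y \<in> ?B then pmf \<pi> y / measure_pmf.prob \<pi> ?B * f $ x else 0)"
    unfolding matrix_vector_mult_def gibbs_kernel_def
    by (auto simp: const intro!: sum.cong)
  also have "\<dots> = (\<Sum>y\<in>?B. pmf \<pi> y) / measure_pmf.prob \<pi> ?B * f $ x"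
    by (simp add: sum.If_cases sum_distrib_right sum_divide_distrib)
  also have "\<dots> = f $ x"
    using pos by (simp add: measure_measure_pmf_finite)
  finally show "(gibbs_kernel \<pi> \<O> *v f) $ x = f $ x" .
qed

lemma gibbs_kernel_neq_stationary_matrix:
  assumes "gibbs_kernel \<pi> \<O> \<noteq> stationary_matrix \<pi>"
  obtains x where "block_of \<O> x \<noteq> UNIV"
proof (rule ccontr)
  assume "\<not> thesis"
  then have "block_of \<O> x = UNIV" for x
    using that by blast
  then have "gibbs_kernel \<pi> \<O> = stationary_matrix \<pi>"
    by (simp add: gibbs_kernel_def stationary_matrix_def)
  with assms show False by simp
qed

theorem proposition7p4:
  fixes \<pi> :: "'a::finite pmf" and \<O> :: "'a set set" and P :: "real^'a^'a"
  assumes "\<And>x. 0 < pmf \<pi> x"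
    and "partition_on UNIV \<O>"
    and "transition_matrix P"
    and "reversible \<pi> P"
    and "ergodic_matrix P"
    and "positive_definite \<pi> P"
    and "gibbs_kernel \<pi> \<O> \<noteq> stationary_matrix \<pi>"
    and "P \<noteq> stationary_matrix \<pi>"
  shows "gibbs_kernel \<pi> \<O> ** P ** gibbs_kernel \<pi> \<O> \<noteq> stationary_matrix \<pi>"
proof
  let ?G = "gibbs_kernel \<pi> \<O>"
  assume eq: "?G ** P ** ?G = stationary_matrix \<pi>"
  obtain b where b: "block_of \<O> b \<noteq> UNIV"
    using gibbs_kernel_neq_stationary_matrix[OF assms(7)] .
  let ?B = "block_of \<O> b"
  define f :: "real^'a" where "f = (\<chi> x. indicator ?B x - measure_pmf.prob \<pi> ?B)"
  obtain c where c: "c \<notin> ?B" using b by blast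
  \<comment> \<open>The shift by \<pi>(B) cancels in the difference, so its value is
    irrelevant.\<close>
  have "f $ b - f $ c = 1"
    using c in_block_of[OF assms(2)] by (simp add: f_def)
  then have f0: "f \<noteq> 0" by auto
  have Gf: "?G *v f = f"
    by (rule gibbs_kernel_fixes_block_constant[OF assms(1,2)])
      (simp add: f_def indicator_def in_block_of_iff[OF assms(2)])
  have "(\<Sum>y\<in>UNIV. pmf \<pi> y * indicator ?B y) = measure_pmf.prob \<pi> ?B"
    by (simp add: indicator_def sum.If_cases measure_measure_pmf_finite if_distrib cong: if_cong)
  moreover have "(\<Sum>y\<in>UNIV. pmf \<pi> y) = 1"
    by (rule sum_pmf_eq_1) auto
  ultimately have "stationary_matrix \<pi> *v f = 0"
    by (simp add: vec_eq_iff matrix_vector_mult_def stationary_matrix_def f_def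
        right_diff_distrib sum_subtractf flip: sum_distrib_right)
  \<comment> \<open>Here GPf = GPGf = \<Pi>f = 0.\<close>
  then have GPf: "?G *v (P *v f) = 0"
    using eq Gf by (metis matrix_vector_mul_assoc)
  \<comment> \<open>Self-adjointness moves \<open>G\<close> from \<open>P *v f\<close> onto the left
    factor, which it fixes.\<close>
  have "(\<Sum>x\<in>UNIV. f $ x * (P *v f) $ x * pmf \<pi> x)
      = (\<Sum>x\<in>UNIV. f $ x * (?G *v (P *v f)) $ x * pmf \<pi> x)"
    unfolding reversible_self_adjoint[OF reversible_gibbs_kernel[OF assms(2)]] Gf ..
  also have "\<dots> = 0"
    by (simp add: GPf)
  finally show False
    using assms(6) f0 unfolding positive_definite_def by fastforce
qed

end
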